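(* Let $d$ be a positive integer and let $X$ be a polynomial hypergroup in $d$ variables associated with the family of polynomials $\{Q_x:x\in X\}$. Identify the set of all exponentials on $X$ with $\mathbb{C}^d$ by letting $\lambda\in\mathbb{C}^d$ correspond to the exponential $x\mapsto Q_x(\lambda)$. Then the Fourier algebra $\mathcal{A}(X)$, regarded as an algebra of complex valued functions on $\mathbb{C}^d$, is the polynomial ring $\mathbb{C}[z_1,z_2,\dots,z_d]$ in $d$ variables.
   Context: A (discrete) commutative hypergroup is a set $X$ with a bilinear, associative, commutative convolution $*$ of bounded complex measures such that each $\delta_x*\delta_y$ is a finitely supported probability measure, with an identity $o\in X$ ($\delta_o*\delta_x=\delta_x$) and an involution $x\mapsto\check x$ with $(\delta_x*\delta_y)\check{\ }=\delta_{\check y}*\delta_{\check x}$ (image measure) and $o\in\mathrm{supp}(\delta_x*\delta_y)$ if and only if $x=\check y$. Polynomial hypergroup in $d$ variables: let $\mathcal{P}_n$ be the space of complex polynomials on $\mathbb{C}^d$ of degree at most $n$. A commutative hypergroup $X$ (with discrete topology) is a polynomial hypergroup in $d$ variables, associated with the family of polynomials $\{Q_x:x\in X\}$ on $\mathbb{C}^d$, if there is a probability measure $\pi$ on $\mathbb{C}^d$ such that: (P1) for each $n\ge0$, the polynomials $Q_x$ with $x\in X_n=\{x\in X: Q_x\in\mathcal{P}_n\}$ form a basis of $\mathcal{P}_n$; (P2) $Q_x(1,1,\dots,1)=1$ for each $x\in X$; (P3) $Q_{\check x}(z)=\overline{Q_x(z)}$ for each $x\in X$ and $z\in\mathrm{supp}\,\pi$;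 (P4) $\int_{\mathbb{C}^d}Q_xQ_yQ_w\,d\pi\ge0$ for all $x,y,w\in X$; and, writing $Q_xQ_y=\sum_{w\in X}c(x,y,w)Q_w$ for the unique (finite) expansion given by (P1), the convolution is $\delta_x*\delta_y=\sum_{w\in X}c(x,y,w)\delta_w$ for all $x,y\in X$. It is always assumed that $Q_o=1$, where $o$ is the identity of $X$. For $h:X\to\mathbb{C}$ write $h(x*y)=\int_X h\,d(\delta_x*\delta_y)$ and $\check h(x)=h(\check x)$. An exponential on $X$ is a not identically zero function $m:X\to\mathbb{C}$ with $m(x*y)=m(x)m(y)$ for all $x,y\in X$. It is known that $m$ is an exponential on $X$ if and only if there is a (unique) $\lambda\in\mathbb{C}^d$ with $m(x)=Q_x(\lambda)$ for all $x\in X$. $\mathcal{M}_c(X)$ is the convolution algebra of compactly (here: finitely) supported complex measures on $X$. The Fourier–Laplace transform of $\mu\in\mathcal{M}_c(X)$ is the function $\hat\mu$ on the set of all exponentials on $X$ given by $\hat\mu(m)=\int_X\check m\,d\mu$. The Fourier algebra $\mathcal{A}(X)$ is the algebra (under pointwise operations) of all functions $\hat\mu$, $\mu\in\mathcal{M}_c(X)$. *)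

theory Defs
  imports "HOL-Probability.Probability" "HOL-Library.Poly_Mapping"
begin

section \<open>Complex polynomials in finitely many variables\<close>

text \<open>
  The polynomial ring over \<^typ>\<open>complex\<close> in the variables indexed by \<open>'d\<close>: an exponent vector
  is of type \<open>'d \<Rightarrow>\<^sub>0 nat\<close>, and the ring operations are those of \<^type>\<open>poly_mapping\<close>.
  The number of variables is the cardinality of the finite (and automatically nonempty) type \<open>'d\<close>.
\<close>

type_synonym 'd cpoly = "('d \<Rightarrow>\<^sub>0 nat) \<Rightarrow>\<^sub>0 complex"

definition monom_fun :: "('d::finite \<Rightarrow>\<^sub>0 nat) \<Rightarrow> complex ^ 'd \<Rightarrow> complex" where
  "monom_fun m z = (\<Prod>i\<in>UNIV. (z $ i) ^ Poly_Mapping.lookup m i)"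

definition poly_fun :: "'d::finite cpoly \<Rightarrow> complex ^ 'd \<Rightarrow> complex" where
  "poly_fun p z = (\<Sum>m\<in>Poly_Mapping.keys p. Poly_Mapping.lookup p m * monom_fun m z)"

definition polys_le :: "nat \<Rightarrow> 'd::finite cpoly set" where
  "polys_le n = {p. \<forall>m\<in>Poly_Mapping.keys p. (\<Sum>i\<in>UNIV. Poly_Mapping.lookup m i) \<le> n}"

definition cscale :: "complex \<Rightarrow> 'd cpoly \<Rightarrow> 'd cpoly" where
  "cscale c p = Poly_Mapping.map ((*) c) p"

lemma cscale_conv_mult: "cscale c p = Poly_Mapping.single 0 c * p"
  by (simp add: cscale_def mult_map_scale_conv_mult)

lemma cscale_laws:
  "cscale a (p + q) = cscale a p + cscale a q"
  "cscale (a + b) p = cscale a p + cscale b p"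
  "cscale a (cscale b p) = cscale (a * b) p"
  "cscale 1 p = p"
proof -
  show "cscale a (p + q) = cscale a p + cscale a q"
    by (simp only: cscale_conv_mult distrib_left)
  show "cscale (a + b) p = cscale a p + cscale b p"
    by (simp only: cscale_conv_mult distrib_right single_add)
  show "cscale a (cscale b p) = cscale (a * b) p"
    by (simp only: cscale_conv_mult mult.assoc[symmetric] mult_single add_0_left)
  show "cscale 1 p = p"
    by (simp only: cscale_conv_mult single_one mult_1_left)
qed

global_interpretation cpoly: vector_space "cscale :: complex \<Rightarrow> 'd cpoly \<Rightarrow> 'd cpoly"
  by unfold_locales (fact cscale_laws)+

text \<open>
  Evaluation is an injective algebra homomorphism, so the polynomial ring may be regarded as
  the algebra of functions \<open>range poly_fun\<close>.
\<close>

lemma poly_fun_superset: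
  assumes "finite S" "Poly_Mapping.keys p \<subseteq> S"
  shows "poly_fun p z = (\<Sum>m\<in>S. Poly_Mapping.lookup p m * monom_fun m z)"
  unfolding poly_fun_def
  by (rule sum.mono_neutral_left) (use assms in \<open>auto simp: in_keys_iff\<close>)

lemma poly_fun_single: "poly_fun (Poly_Mapping.single m c) z = c * monom_fun m z"
  by (subst poly_fun_superset[of "{m}"]) (auto split: if_splits)

lemma poly_fun_const: "poly_fun (Poly_Mapping.single 0 c) z = c"
  by (simp add: poly_fun_single monom_fun_def)

lemma poly_fun_add: "poly_fun (p + q) z = poly_fun p z + poly_fun q z"
proof -
  let ?S = "Poly_Mapping.keys p \<union> Poly_Mapping.keys q"
  have "poly_fun (p + q) z = (\<Sum>m\<in>?S. Poly_Mapping.lookup (p + q) m * monom_fun m z)"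
    by (rule poly_fun_superset) (use keys_add[of p q] in auto)
  also have "\<dots> = (\<Sum>m\<in>?S. Poly_Mapping.lookup p m * monom_fun m z)
      + (\<Sum>m\<in>?S. Poly_Mapping.lookup q m * monom_fun m z)"
    by (simp add: lookup_add algebra_simps sum.distrib)
  also have "\<dots> = poly_fun p z + poly_fun q z"
    by (simp add: poly_fun_superset[of ?S])
  finally show ?thesis .
qed

lemma poly_fun_sum: "poly_fun (\<Sum>a\<in>A. p a) z = (\<Sum>a\<in>A. poly_fun (p a) z)"
proof -
  have "poly_fun 0 z = 0" by (simp add: poly_fun_def)
  then show ?thesis
    by (induction A rule: infinite_finite_induct) (simp_all add: poly_fun_add)
qed

lemma cpoly_sum_monomials:
  "p = (\<Sum>m\<in>Poly_Mapping.keys p. Poly_Mapping.single m (Poly_Mapping.lookup p m))"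
  by (rule poly_mapping_eqI) (simp add: lookup_sum lookup_single when_def in_keys_iff)

lemma poly_fun_mult: "poly_fun (p * q) z = poly_fun p z * poly_fun q z"
proof -
  let ?P = "Poly_Mapping.keys p" and ?Q = "Poly_Mapping.keys q"
  let ?a = "Poly_Mapping.lookup p" and ?b = "Poly_Mapping.lookup q"
  have "p * q = (\<Sum>m\<in>?P. Poly_Mapping.single m (?a m)) * (\<Sum>k\<in>?Q. Poly_Mapping.single k (?b k))"
    using cpoly_sum_monomials[of p] cpoly_sum_monomials[of q] by (rule arg_cong2)
  also have "\<dots> = (\<Sum>m\<in>?P. \<Sum>k\<in>?Q. Poly_Mapping.single (m + k) (?a m * ?b k))"
    by (simp only: sum_product mult_single)
  finally have "poly_fun (p * q) z = (\<Sum>m\<in>?P. \<Sum>k\<in>?Q. (?a m * ?b k) * monom_fun (m + k) z)"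
    by (simp only: poly_fun_sum poly_fun_single)
  also have "\<dots> = (\<Sum>m\<in>?P. \<Sum>k\<in>?Q. (?a m * monom_fun m z) * (?b k * monom_fun k z))"
    by (simp add: monom_fun_def lookup_add power_add prod.distrib mult_ac)
  also have "\<dots> = poly_fun p z * poly_fun q z"
    by (simp only: poly_fun_def sum_product)
  finally show ?thesis .
qed

lemma poly_fun_cscale: "poly_fun (cscale c p) z = c * poly_fun p z"
  by (simp add: cscale_conv_mult poly_fun_mult poly_fun_const)

lemma monom_fun_independent:
  fixes c :: "('d::finite \<Rightarrow>\<^sub>0 nat) \<Rightarrow> complex"
  assumes "finite S" "\<And>z. (\<Sum>m\<in>S. c m * monom_fun m z) = 0" "m \<in> S"
  shows "c m = 0"
  using assms
proof (induction S arbitrary: c m rule: finite_induct)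
  case (insert k S)
  have S: "c l = 0" if "l \<in> S" for l
  proof -
    from that insert.hyps have "l \<noteq> k" by auto
    then obtain i where i: "Poly_Mapping.lookup l i \<noteq> Poly_Mapping.lookup k i"
      by (metis poly_mapping_eqI)
    define w :: "complex ^ 'd" where "w = (\<chi> j. if j = i then 2 else 1)"
    have w: "monom_fun n w = 2 ^ Poly_Mapping.lookup n i" for n
    proof -
      have "monom_fun n w = (\<Prod>j\<in>UNIV. if j = i then 2 ^ Poly_Mapping.lookup n i else 1)"
        unfolding monom_fun_def w_def by (rule prod.cong) auto
      then show ?thesis by simp
    qed
    have ne: "monom_fun l w - monom_fun k w \<noteq> 0"
    proof
      assume "monom_fun l w - monom_fun k w = 0"
      then have "of_nat (2 ^ Poly_Mapping.lookup l i) = (of_nat (2 ^ Poly_Mapping.lookup k i) :: complex)"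
        by (simp add: w)
      then show False using i unfolding of_nat_eq_iff by simp
    qed
    have mult: "monom_fun n (\<chi> j. w $ j * z $ j) = monom_fun n w * monom_fun n z" for n z
      by (simp add: monom_fun_def power_mult_distrib prod.distrib)
    have "c l * (monom_fun l w - monom_fun k w) = 0"
    proof (rule insert.IH[OF _ that])
      fix z :: "complex ^ 'd"
      have 1: "c k * monom_fun k z + (\<Sum>n\<in>S. c n * monom_fun n z) = 0"
        using insert.prems(1)[of z] insert.hyps by simp
      have 2: "c k * (monom_fun k w * monom_fun k z)
                 + (\<Sum>n\<in>S. c n * (monom_fun n w * monom_fun n z)) = 0"
        using insert.prems(1)[of "\<chi> j. w $ j * z $ j"] insert.hyps by (simp add: mult)
      have "(\<Sum>n\<in>S. c n * (monom_fun n w - monom_fun k w) * monom_fun n z)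
          = (\<Sum>n\<in>S. c n * (monom_fun n w * monom_fun n z))
              - monom_fun k w * (\<Sum>n\<in>S. c n * monom_fun n z)"
        by (simp add: sum_distrib_left left_diff_distrib right_diff_distrib sum_subtractf mult_ac)
      also have "\<dots> = (c k * (monom_fun k w * monom_fun k z)
                 + (\<Sum>n\<in>S. c n * (monom_fun n w * monom_fun n z)))
              - monom_fun k w * (c k * monom_fun k z + (\<Sum>n\<in>S. c n * monom_fun n z))"
        by (simp only: distrib_left) simp
      also have "\<dots> = 0"
        by (simp only: 1 2) simp
      finally show "(\<Sum>n\<in>S. c n * (monom_fun n w - monom_fun k w) * monom_fun n z) = 0" .
    qed
    with ne show ?thesis by simp
  qed
  moreover have "c k = 0"
    using insert.prems(1)[of "\<chi> j. 1"] insert.hyps S by (simp add: monom_fun_def)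
  ultimately show ?case using insert.prems(2) by auto
qed simp

lemma inj_poly_fun: "inj (poly_fun :: 'd::finite cpoly \<Rightarrow> _)"
proof (rule injI, rule poly_mapping_eqI)
  fix p q :: "'d cpoly" and m
  assume eq: "poly_fun p = poly_fun q"
  let ?S = "insert m (Poly_Mapping.keys p \<union> Poly_Mapping.keys q)"
  have "Poly_Mapping.lookup p m - Poly_Mapping.lookup q m = 0"
  proof (rule monom_fun_independent[of ?S "\<lambda>m. Poly_Mapping.lookup p m - Poly_Mapping.lookup q m"])
    fix z
    have "(\<Sum>n\<in>?S. (Poly_Mapping.lookup p n - Poly_Mapping.lookup q n) * monom_fun n z) = poly_fun p z - poly_fun q z"
      by (subst (1 2) poly_fun_superset[of ?S]) (auto simp: left_diff_distrib sum_subtractf)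
    then show "(\<Sum>n\<in>?S. (Poly_Mapping.lookup p n - Poly_Mapping.lookup q n) * monom_fun n z) = 0"
      by (simp add: eq)
  qed auto
  then show "Poly_Mapping.lookup p m = Poly_Mapping.lookup q m" by simp
qed

section \<open>Discrete commutative hypergroups\<close>

text \<open>
  The underlying set is the type \<open>'x\<close>, and \<open>conv x y\<close> is the probability measure
  \<open>\<delta>\<^sub>x * \<delta>\<^sub>y\<close>. The convolution of arbitrary measures is the (bi)linear extension of \<open>conv\<close>;
  so \<open>(\<delta>\<^sub>x * \<delta>\<^sub>y) * \<delta>\<^sub>z\<close> is the mixture of the measures \<open>conv w z\<close> with respect to \<open>conv x y\<close>,
  and associativity and commutativity are conditions on point measures.
\<close>

locale commutative_hypergroup =
  fixes conv :: "'x \<Rightarrow> 'x \<Rightarrow> 'x pmf"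
    and e :: 'x
    and chk :: "'x \<Rightarrow> 'x"
  assumes finite_support: "finite (set_pmf (conv x y))"
    and assoc: "bind_pmf (conv x y) (\<lambda>w. conv w z) = bind_pmf (conv y z) (\<lambda>w. conv x w)"
    and commute: "conv x y = conv y x"
    and identity: "conv e x = return_pmf x"
    and involution: "chk (chk x) = x"
    and involution_conv: "map_pmf chk (conv x y) = conv (chk y) (chk x)"
    and identity_in_support_iff: "e \<in> set_pmf (conv x y) \<longleftrightarrow> x = chk y"

section \<open>Polynomial hypergroups\<close>

definition measure_support :: "'a::topological_space measure \<Rightarrow> 'a set" where
  "measure_support M = {z. \<forall>U. open U \<longrightarrow> z \<in> U \<longrightarrow> emeasure M U > 0}"

text \<open>
  The set \<open>{x. Q x \<in> polys_le n}\<close> is \<open>X\<^sub>n\<close>; that the \<^emph>\<open>family\<close> \<open>Q\<close> restricted to it is a basis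
  includes injectivity. By \<open>basis\<close> the coefficients in \<open>product_expansion\<close> are the unique
  \<open>c(x, y, w)\<close>. Integrability is explicit in \<open>orthogonality\<close> since the Bochner integral of a
  function that is not integrable is 0.
\<close>

locale polynomial_hypergroup = commutative_hypergroup conv e chk
  for conv :: "'x \<Rightarrow> 'x \<Rightarrow> 'x pmf" and e :: 'x and chk :: "'x \<Rightarrow> 'x" +
  fixes Q :: "'x \<Rightarrow> 'd::finite cpoly"
  assumes Q_identity: "Q e = 1"
    and basis: "inj_on Q {x. Q x \<in> polys_le n}"
               "cpoly.independent (Q ` {x. Q x \<in> polys_le n})"
               "cpoly.span (Q ` {x. Q x \<in> polys_le n}) = polys_le n"
    and normalized: "poly_fun (Q x) (\<chi> i. 1) = 1"
    and product_expansion: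
      "Q x * Q y = (\<Sum>w\<in>set_pmf (conv x y). cscale (complex_of_real (pmf (conv x y) w)) (Q w))"
    and orthogonality:
      "\<exists>\<pi> :: (complex ^ 'd) measure. prob_space \<pi> \<and> sets \<pi> = sets borel \<and>
         (\<forall>x. \<forall>z\<in>measure_support \<pi>. poly_fun (Q (chk x)) z = cnj (poly_fun (Q x) z)) \<and>
         (\<forall>x y w. integrable \<pi> (\<lambda>z. poly_fun (Q x) z * poly_fun (Q y) z * poly_fun (Q w) z) \<and>
            (LINT z|\<pi>. poly_fun (Q x) z * poly_fun (Q y) z * poly_fun (Q w) z) \<in> \<real>\<^sub>\<ge>\<^sub>0)"

section \<open>Exponentials and the Fourier algebra\<close>

definition exponentials :: "('x \<Rightarrow> 'x \<Rightarrow> 'x pmf) \<Rightarrow> ('x \<Rightarrow> complex) set" where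
  "exponentials conv =
     {m. m \<noteq> (\<lambda>x. 0) \<and> (\<forall>x y. measure_pmf.expectation (conv x y) m = m x * m y)}"

text \<open>
  A finitely supported complex measure on \<open>'x\<close> is an element of \<open>'x \<Rightarrow>\<^sub>0 complex\<close>, giving the mass
  of each point. Its transform is a function on the set of exponentials only.
\<close>

definition fourier_laplace ::
    "('x \<Rightarrow> 'x \<Rightarrow> 'x pmf) \<Rightarrow> ('x \<Rightarrow> 'x) \<Rightarrow> ('x \<Rightarrow>\<^sub>0 complex) \<Rightarrow> ('x \<Rightarrow> complex) \<Rightarrow> complex" where
  "fourier_laplace conv chk \<mu> =
     (\<lambda>m\<in>exponentials conv. \<Sum>x\<in>Poly_Mapping.keys \<mu>. m (chk x) * Poly_Mapping.lookup \<mu> x)"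

definition fourier_algebra ::
    "('x \<Rightarrow> 'x \<Rightarrow> 'x pmf) \<Rightarrow> ('x \<Rightarrow> 'x) \<Rightarrow> (('x \<Rightarrow> complex) \<Rightarrow> complex) set" where
  "fourier_algebra conv chk = range (fourier_laplace conv chk)"

end

theory Submission
  imports Defs
begin

text \<open>
  The polynomials \<open>Q x\<close> form a linear basis of the whole polynomial ring, and the convolution of
  point masses records the structure constants of multiplication in that basis. Hence the finitely
  supported measures form, as an algebra under convolution, a copy of the polynomial ring with
  \<open>\<delta>\<^sub>x\<close> playing the role of \<open>Q x\<close>, and an exponential is the same thing as a character of the
  polynomial ring, read off on the basis. Explicitly, the linear extension of an exponential \<open>m\<close>
  along \<open>Q x \<mapsto> m x\<close> is multiplicative on the basis, hence multiplicative; a unital multiplicative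
  functional on the polynomial ring is evaluation at the point of its values on the
  coordinates (\<open>cpoly_character_is_evaluation\<close>), so \<open>m x = Q\<^sub>x(\<lambda>)\<close>
  (\<open>exponential_is_evaluation\<close>). Two points giving the same exponential agree on the span of the
  basis, in particular on the coordinates, so \<open>\<lambda>\<close> is unique.

  Under this identification the transform of a measure with masses \<open>\<mu>\<^sub>x\<close> is the function given by
  the polynomial \<open>\<Sum>\<^sub>x \<mu>\<^sub>x Q\<^bsub>chk x\<^esub>\<close>. As \<open>chk\<close> is a permutation, these are all finite linear
  combinations of the basis, that is, all polynomials (\<open>fourier_laplace_evaluation\<close>).
\<close>

section \<open>Characters of the polynomial ring\<close>

definition var :: "'d \<Rightarrow> 'd cpoly" where
  "var i = Poly_Mapping.single (Poly_Mapping.single i 1) 1"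

lemma poly_fun_var: "poly_fun (var i) z = z $ i"
proof -
  have "monom_fun (Poly_Mapping.single i 1) z = (\<Prod>j\<in>UNIV. if j = i then z $ i else 1)"
    unfolding monom_fun_def by (rule prod.cong) (auto simp: lookup_single when_def)
  then show ?thesis by (simp add: var_def poly_fun_single)
qed

lemma poly_fun_one: "poly_fun 1 z = 1"
  using poly_fun_const[of 1 z] by simp

lemma poly_fun_power: "poly_fun (p ^ n) z = poly_fun p z ^ n"
  by (induction n) (simp_all add: poly_fun_one poly_fun_mult)

lemma poly_fun_prod: "poly_fun (\<Prod>a\<in>A. p a) z = (\<Prod>a\<in>A. poly_fun (p a) z)"
  by (induction A rule: infinite_finite_induct) (simp_all add: poly_fun_one poly_fun_mult)

lemma single_conv_var:
  fixes m :: "'d::finite \<Rightarrow>\<^sub>0 nat"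
  shows "Poly_Mapping.single m c = cscale c (\<Prod>i\<in>UNIV. var i ^ Poly_Mapping.lookup m i)"
proof (rule injD[OF inj_poly_fun], rule ext)
  fix z :: "complex ^ 'd"
  show "poly_fun (Poly_Mapping.single m c) z =
        poly_fun (cscale c (\<Prod>i\<in>UNIV. var i ^ Poly_Mapping.lookup m i)) z"
    by (simp add: poly_fun_single poly_fun_cscale poly_fun_prod poly_fun_power poly_fun_var
        monom_fun_def)
qed

text \<open>
  The points of affine space are the characters of its polynomial ring, since the coordinates
  generate the ring as an algebra.
\<close>

lemma cpoly_character_is_evaluation:
  fixes \<phi> :: "'d::finite cpoly \<Rightarrow> complex"
  assumes lin: "Vector_Spaces.linear cscale (*) \<phi>"
    and one: "\<phi> 1 = 1"
    and mult: "\<And>p q. \<phi> (p * q) = \<phi> p * \<phi> q"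
  shows "\<phi> p = poly_fun p (\<chi> i. \<phi> (var i))"
proof -
  interpret Vector_Spaces.linear cscale "(*)" \<phi> by (fact lin)
  have pow: "\<phi> (q ^ n) = \<phi> q ^ n" for q n
    by (induction n) (simp_all add: one mult)
  have prod: "\<phi> (\<Prod>a\<in>A. q a) = (\<Prod>a\<in>A. \<phi> (q a))" for q :: "'d \<Rightarrow> 'd cpoly" and A
    by (induction A rule: infinite_finite_induct) (simp_all add: one mult)
  have "\<phi> p = (\<Sum>m\<in>Poly_Mapping.keys p. \<phi> (Poly_Mapping.single m (Poly_Mapping.lookup p m)))"
    by (subst cpoly_sum_monomials) (rule sum)
  also have "\<dots> = poly_fun p (\<chi> i. \<phi> (var i))"
    by (simp add: single_conv_var scale prod pow poly_fun_def monom_fun_def)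
  finally show ?thesis .
qed

section \<open>The polynomials of a polynomial hypergroup\<close>

lemma polys_le_mono: "m \<le> n \<Longrightarrow> polys_le m \<subseteq> polys_le n"
  by (force simp: polys_le_def)

lemma finite_subset_polys_le:
  fixes P :: "'d::finite cpoly set"
  assumes "finite P"
  shows "\<exists>n. P \<subseteq> polys_le n"
  using assms
proof induction
  case (insert p P)
  then obtain n where n: "P \<subseteq> polys_le n" by auto
  let ?k = "\<Sum>m\<in>Poly_Mapping.keys p. \<Sum>i\<in>UNIV. Poly_Mapping.lookup m i"
  have "p \<in> polys_le ?k"
    unfolding polys_le_def by (auto intro: member_le_sum)
  then have "insert p P \<subseteq> polys_le (max n ?k)"
    using n polys_le_mono[of n "max n ?k"] polys_le_mono[of ?k "max n ?k"] by auto
  then show ?case by blast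
qed simp

context polynomial_hypergroup
begin

text \<open>
  The basis property on the whole ring follows from that of the filtration \<open>polys_le\<close>, because
  finitely many polynomials always lie in a common \<open>polys_le n\<close>.
\<close>

lemma Q_inj: "inj Q"
proof (rule injI)
  fix x y assume eq: "Q x = Q y"
  obtain n where "{Q x, Q y} \<subseteq> polys_le n"
    using finite_subset_polys_le[of "{Q x, Q y}"] by auto
  then show "x = y"
    using inj_onD[OF basis(1)[of n] eq] by simp
qed

lemma Q_independent: "cpoly.independent (range Q)"
proof
  assume "cpoly.dependent (range Q)"
  then obtain S u v where S: "finite S" "S \<subseteq> range Q" "(\<Sum>v\<in>S. cscale (u v) v) = 0"
    "v \<in> S" "u v \<noteq> 0"
    unfolding cpoly.dependent_explicit by blast
  obtain n where "S \<subseteq> polys_le n"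
    using finite_subset_polys_le[OF S(1)] by auto
  then have "S \<subseteq> Q ` {x. Q x \<in> polys_le n}" using S(2) by auto
  then have "cpoly.dependent (Q ` {x. Q x \<in> polys_le n})"
    unfolding cpoly.dependent_explicit using S by blast
  then show False using basis(2)[of n] by blast
qed

lemma Q_span: "cpoly.span (range Q) = UNIV"
proof (intro equalityI subsetI)
  fix p :: "'d cpoly"
  obtain n where "p \<in> polys_le n"
    using finite_subset_polys_le[of "{p}"] by auto
  then have "p \<in> cpoly.span (Q ` {x. Q x \<in> polys_le n})" by (simp add: basis(3))
  then show "p \<in> cpoly.span (range Q)"
    using cpoly.span_mono[of "Q ` {x. Q x \<in> polys_le n}" "range Q"] by auto
qed simp

lemma Q_expansion: "\<exists>\<mu>. p = (\<Sum>x\<in>Poly_Mapping.keys \<mu>. cscale (Poly_Mapping.lookup \<mu> x) (Q x))"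
proof -
  let ?f = "\<lambda>\<mu> x. cscale (Poly_Mapping.lookup \<mu> x) (Q x)"
  have "p \<in> cpoly.span (range Q)" by (simp add: Q_span)
  then show ?thesis
  proof (induction rule: cpoly.span_induct_alt)
    case base
    show ?case by (rule exI[of _ 0]) simp
  next
    case (step c q r)
    then obtain y \<mu> where q: "q = Q y" and r: "r = (\<Sum>x\<in>Poly_Mapping.keys \<mu>. ?f \<mu> x)" by auto
    let ?\<nu> = "\<mu> + Poly_Mapping.single y c"
    let ?S = "insert y (Poly_Mapping.keys \<mu>)"
    have "(\<Sum>x\<in>Poly_Mapping.keys ?\<nu>. ?f ?\<nu> x) = (\<Sum>x\<in>?S. ?f ?\<nu> x)"
      using keys_add[of \<mu> "Poly_Mapping.single y c"]
      by (intro sum.mono_neutral_left) (auto simp: in_keys_iff split: if_splits)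
    also have "\<dots> = (\<Sum>x\<in>?S. ?f \<mu> x) + (\<Sum>x\<in>?S. if x = y then cscale c (Q x) else 0)"
      unfolding sum.distrib[symmetric]
      by (rule sum.cong) (auto simp: lookup_add lookup_single when_def cpoly.scale_left_distrib)
    also have "\<dots> = r + cscale c q"
    proof -
      have "(\<Sum>x\<in>?S. ?f \<mu> x) = r" unfolding r
        by (intro sum.mono_neutral_right) (auto simp: in_keys_iff)
      then show ?thesis by (simp add: q)
    qed
    finally show ?case by (intro exI[of _ ?\<nu>]) (simp add: add.commute)
  qed
qed

lemma expectation_conv:
  fixes f :: "'x \<Rightarrow> complex"
  shows "measure_pmf.expectation (conv x y) f =
         (\<Sum>w\<in>set_pmf (conv x y). complex_of_real (pmf (conv x y) w) * f w)"
  by (subst integral_measure_pmf[OF finite_support])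
     (auto simp: scaleR_conv_of_real set_pmf_iff)

section \<open>Exponentials\<close>

lemma evaluation_exponential: "(\<lambda>x. poly_fun (Q x) l) \<in> exponentials conv"
proof -
  have "poly_fun (Q e) l \<noteq> 0" by (simp add: Q_identity poly_fun_one)
  then have "(\<lambda>x. poly_fun (Q x) l) \<noteq> (\<lambda>x. 0)" by metis
  moreover have "measure_pmf.expectation (conv x y) (\<lambda>x. poly_fun (Q x) l)
      = poly_fun (Q x) l * poly_fun (Q y) l" for x y
    unfolding expectation_conv poly_fun_mult[symmetric] product_expansion
    by (simp add: poly_fun_sum poly_fun_cscale)
  ultimately show ?thesis by (simp add: exponentials_def)
qed

lemma evaluation_inj: "inj (\<lambda>l x. poly_fun (Q x) l)"
proof (rule injI)
  fix k l :: "complex ^ 'd"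
  assume "(\<lambda>x. poly_fun (Q x) k) = (\<lambda>x. poly_fun (Q x) l)"
  then have eq: "poly_fun (Q x) k = poly_fun (Q x) l" for x by (rule fun_cong)
  have "poly_fun p k = poly_fun p l" for p
    using Q_expansion[of p] by (auto simp: poly_fun_sum poly_fun_cscale eq)
  from this[of "var i" for i] show "k = l" by (simp add: poly_fun_var vec_eq_iff)
qed

text \<open>
  The linear extension of an exponential is multiplicative on pairs of basis elements by
  \<open>product_expansion\<close>, and both sides of the multiplicativity law are bilinear.
\<close>

lemma exponential_is_evaluation:
  assumes "m \<in> exponentials conv"
  shows "\<exists>l. m = (\<lambda>x. poly_fun (Q x) l)"
proof -
  interpret C: vector_space_pair "cscale :: complex \<Rightarrow> 'd cpoly \<Rightarrow> 'd cpoly"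
      "(*) :: complex \<Rightarrow> complex \<Rightarrow> complex"
    by unfold_locales (auto simp: algebra_simps)
  from assms have nz: "m \<noteq> (\<lambda>x. 0)"
    and exp: "measure_pmf.expectation (conv x y) m = m x * m y" for x y
    by (auto simp: exponentials_def)
  obtain \<phi> where lin: "Vector_Spaces.linear cscale (*) \<phi>"
    and "\<forall>p\<in>range Q. \<phi> p = (m \<circ> inv Q) p"
    using C.linear_independent_extend[OF Q_independent] by blast
  then have \<phi>Q: "\<phi> (Q x) = m x" for x by (simp add: inv_f_f[OF Q_inj])
  interpret Vector_Spaces.linear cscale "(*)" \<phi> by (fact lin)
  have basis_mult: "\<phi> (Q x * Q y) = \<phi> (Q x) * \<phi> (Q y)" for x y
    unfolding product_expansion by (simp add: sum scale \<phi>Q exp[symmetric] expectation_conv)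
  have cscale_mult: "cscale c p * q = cscale c (p * q)" "q * cscale c p = cscale c (q * p)"
    for c and p q :: "'d cpoly"
    by (simp_all add: cscale_conv_mult ac_simps)
  have left_mult: "\<phi> (p * Q y) = \<phi> p * \<phi> (Q y)" for p y
    using Q_expansion[of p]
    by (auto simp: sum_distrib_right cscale_mult sum scale basis_mult mult.assoc)
  have mult: "\<phi> (p * q) = \<phi> p * \<phi> q" for p q
    using Q_expansion[of q]
    by (auto simp: sum_distrib_left cscale_mult sum scale left_mult
        mult.left_commute[where 'a = complex])
  obtain x where "m x \<noteq> 0" using nz by auto
  moreover have "m e * m x = m x"
    using exp[of e x] by (simp add: identity)
  ultimately have "\<phi> 1 = 1"
    using \<phi>Q[of e] by (simp add: Q_identity)
  then have "\<phi> (Q x) = poly_fun (Q x) (\<chi> i. \<phi> (var i))" for x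
    by (intro cpoly_character_is_evaluation lin mult)
  then show ?thesis by (auto simp: \<phi>Q)
qed

section \<open>The Fourier algebra\<close>

lemma fourier_laplace_evaluation:
  "fourier_laplace conv chk \<mu> (\<lambda>x. poly_fun (Q x) l) =
   poly_fun (\<Sum>x\<in>Poly_Mapping.keys \<mu>. cscale (Poly_Mapping.lookup \<mu> x) (Q (chk x))) l"
  by (simp add: fourier_laplace_def evaluation_exponential poly_fun_sum poly_fun_cscale mult.commute)

text \<open>
  The measure with transform \<open>p\<close> is the image under \<open>chk\<close> of the coefficients of \<open>p\<close> in the
  basis \<open>Q\<close>.
\<close>

lemma fourier_laplace_surj:
  "\<exists>\<mu>. \<forall>l. fourier_laplace conv chk \<mu> (\<lambda>x. poly_fun (Q x) l) = poly_fun p l"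
proof -
  obtain \<mu> where p: "p = (\<Sum>x\<in>Poly_Mapping.keys \<mu>. cscale (Poly_Mapping.lookup \<mu> x) (Q x))"
    using Q_expansion by blast
  have inj: "inj chk" by (metis injI involution)
  let ?\<nu> = "Poly_Mapping.map_key chk \<mu>"
  have keys: "Poly_Mapping.keys ?\<nu> = chk ` Poly_Mapping.keys \<mu>"
    by (subst keys_map_key[OF inj]) (auto simp: involution image_iff intro!: bexI[of _ "chk _"])
  have "(\<Sum>x\<in>Poly_Mapping.keys ?\<nu>. cscale (Poly_Mapping.lookup ?\<nu> x) (Q (chk x))) = p"
    unfolding keys p
    by (subst sum.reindex) (auto simp: map_key.rep_eq[OF inj] involution intro: inj_on_subset[OF inj])
  then show ?thesis
    by (intro exI[of _ ?\<nu>] allI) (simp only: fourier_laplace_evaluation)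
qed

end

theorem mainTheorem5:
  fixes conv :: "'x \<Rightarrow> 'x \<Rightarrow> 'x pmf" and e :: 'x and chk :: "'x \<Rightarrow> 'x"
    and Q :: "'x \<Rightarrow> 'd::finite cpoly"
  assumes "polynomial_hypergroup conv e chk Q"
  shows "bij_betw (\<lambda>l x. poly_fun (Q x) l) UNIV (exponentials conv) \<and>
         (\<lambda>F l. F (\<lambda>x. poly_fun (Q x) l)) ` fourier_algebra conv chk = range poly_fun"
proof
  interpret polynomial_hypergroup conv e chk Q by (fact assms)
  show "bij_betw (\<lambda>l x. poly_fun (Q x) l) UNIV (exponentials conv)"
    unfolding bij_betw_def
    using evaluation_inj evaluation_exponential exponential_is_evaluation by blast
  show "(\<lambda>F l. F (\<lambda>x. poly_fun (Q x) l)) ` fourier_algebra conv chk = range poly_fun"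
  proof (intro equalityI subsetI)
    fix f assume "f \<in> (\<lambda>F l. F (\<lambda>x. poly_fun (Q x) l)) ` fourier_algebra conv chk"
    then show "f \<in> range poly_fun"
      by (auto simp: fourier_algebra_def fourier_laplace_evaluation)
  next
    fix f :: "complex ^ 'd \<Rightarrow> complex" assume "f \<in> range poly_fun"
    then obtain p where f: "f = poly_fun p" by blast
    obtain \<mu> where "\<forall>l. fourier_laplace conv chk \<mu> (\<lambda>x. poly_fun (Q x) l) = f l"
      using fourier_laplace_surj[of p] f by blast
    then have "f = (\<lambda>l. fourier_laplace conv chk \<mu> (\<lambda>x. poly_fun (Q x) l))" by auto
    then show "f \<in> (\<lambda>F l. F (\<lambda>x. poly_fun (Q x) l)) ` fourier_algebra conv chk"
      unfolding fourier_algebra_def by blast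
  qed
qed

end
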